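(* Let $\sigma\in[0,1)$. For every $E\in\mathcal{M}_{\mathrm f}(\mathbb{R}^d)$, $$\hat J^\sigma(E)=\hat H^\sigma(E).$$ Moreover, $\hat J^\sigma(E)$ and $\hat H^\sigma(E)$ are finite if and only if $H^\sigma_1(E)<+\infty$.
   Context: Let $d\ge1$, let $|E|$ denote Lebesgue measure in $\mathbb{R}^d$, $\omega_d$ the measure of the unit ball, and $B_\rho(x)$ the ball of radius $\rho$ and center $x$. $\mathcal{M}_{\mathrm f}(\mathbb{R}^d)$ is the family of measurable sets $E\subset\mathbb{R}^d$ with $|E|<+\infty$. For $\sigma\in[0,1)$, $\rho>0$ and $E\in\mathcal{M}_{\mathrm f}(\mathbb{R}^d)$ set $$\gamma^\sigma_\rho:=d\omega_d\frac{1-\rho^{-\sigma}}{\sigma}\ \text{ if }\sigma\ne0,\qquad \gamma^0_\rho:=d\omega_d\log\rho,$$ $$H^\sigma_\rho(E):=\int_E\int_{B_\rho(x)\setminus E}\frac{1}{|x-y|^{d+\sigma}}\,dy\,dx,\qquad J^\sigma_\rho(E):=-\int_E\int_{E\setminus B_\rho(x)}\frac{1}{|x-y|^{d+\sigma}}\,dy\,dx,$$ $$\hat J^\sigma_\rho(E):=J^\sigma_\rho(E)-\gamma^\sigma_\rho|E|.$$ Then $\hat J^\sigma(E):=\lim_{r\to0^+}\hat J^\sigma_r(E)\in(-\infty,+\infty]$ (the limit exists because $r\mapsto\hat J^\sigma_r(E)$ is non-increasing). For $\sigma\in(0,1)$, $\hat H^\sigma(E):=\int_E\int_{\mathbb{R}^d\setminus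 E}\frac{1}{|x-y|^{d+\sigma}}\,dy\,dx-\frac{d\omega_d}{\sigma}|E|$, and for $\sigma=0$, $\hat H^0(E):=H^0_1(E)+J^0_1(E)$; both take values in $(-\infty,+\infty]$. *)

theory Defs
  imports "HOL-Analysis.Analysis"
begin

text \<open>
  The space \<open>\<real>\<^sup>d\<close> is an arbitrary \<open>'a :: euclidean_space\<close> with \<open>d = DIM('a)\<close>; since
  \<open>Basis\<close> is nonempty, \<open>d \<ge> 1\<close> is automatic. Double integrals of the nonnegative kernel are
  iterated \<open>ennreal\<close>-valued integrals, so they may be infinite; quantities
  that may be negative or \<open>+\<infinity>\<close> live in \<open>ereal\<close>.
\<close>

text \<open>On the diagonal the kernel takes the junk value 0; for \<open>\<rho> > 0\<close> no integral below meets it.\<close>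

definition frac_kernel :: "real \<Rightarrow> 'a::euclidean_space \<Rightarrow> 'a \<Rightarrow> ennreal" where
  "frac_kernel \<sigma> x y = ennreal (1 / norm (x - y) powr (real DIM('a) + \<sigma>))"

definition omega :: "'a::euclidean_space itself \<Rightarrow> real" where
  "omega TYPE('a) = measure lebesgue (ball (0::'a) 1)"

definition gamma_const :: "'a::euclidean_space itself \<Rightarrow> real \<Rightarrow> real \<Rightarrow> real" where
  "gamma_const TYPE('a) \<sigma> \<rho> =
    (if \<sigma> \<noteq> 0 then real DIM('a) * omega TYPE('a) * ((1 - \<rho> powr (- \<sigma>)) / \<sigma>)
     else real DIM('a) * omega TYPE('a) * ln \<rho>)"

definition H_fun :: "real \<Rightarrow> real \<Rightarrow> 'a::euclidean_space set \<Rightarrow> ennreal" where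
  "H_fun \<sigma> \<rho> E =
    (\<integral>\<^sup>+x\<in>E. (\<integral>\<^sup>+y\<in>ball x \<rho> - E. frac_kernel \<sigma> x y \<partial>lebesgue) \<partial>lebesgue)"

definition J_fun :: "real \<Rightarrow> real \<Rightarrow> 'a::euclidean_space set \<Rightarrow> ereal" where
  "J_fun \<sigma> \<rho> E =
    - enn2ereal (\<integral>\<^sup>+x\<in>E. (\<integral>\<^sup>+y\<in>E - ball x \<rho>. frac_kernel \<sigma> x y \<partial>lebesgue) \<partial>lebesgue)"

definition J_hat_rho :: "real \<Rightarrow> real \<Rightarrow> 'a::euclidean_space set \<Rightarrow> ereal" where
  "J_hat_rho \<sigma> \<rho> E =
    J_fun \<sigma> \<rho> E - ereal (gamma_const TYPE('a) \<sigma> \<rho> * measure lebesgue E)"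

text \<open>
  For \<open>E\<close> measurable of finite measure the limit exists in \<open>(-\<infinity>, +\<infinity>]\<close>, because
  \<open>J_hat_rho \<sigma> r E\<close> is finite and non-increasing in \<open>r > 0\<close>. Without convergence
  \<^const>\<open>Lim\<close> would be an unspecified value.
\<close>

definition J_hat :: "real \<Rightarrow> 'a::euclidean_space set \<Rightarrow> ereal" where
  "J_hat \<sigma> E = Lim (at_right 0) (\<lambda>r. J_hat_rho \<sigma> r E)"

text \<open>
  The differences and sums below are never of the form \<open>\<infinity> - \<infinity>\<close> when \<open>E\<close> has finite
  measure: the subtrahend is real, and \<open>J_fun 0 1 E\<close> is bounded below by \<open>- |E|\<^sup>2\<close>.
\<close>

definition H_hat :: "real \<Rightarrow> 'a::euclidean_space set \<Rightarrow> ereal" where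
  "H_hat \<sigma> E =
    (if \<sigma> = 0 then enn2ereal (H_fun 0 1 E) + J_fun 0 1 E
     else enn2ereal (\<integral>\<^sup>+x\<in>E. (\<integral>\<^sup>+y\<in>UNIV - E. frac_kernel \<sigma> x y \<partial>lebesgue) \<partial>lebesgue)
       - ereal (real DIM('a) * omega TYPE('a) / \<sigma> * measure lebesgue E))"

end

(* In polar coordinates the kernel has integral gamma_R - gamma_r over an annulus of radii r < R,
   and d omega_d / sigma outside the unit ball. Splitting the annulus {r <= |x - y| < 1} into its
   parts inside and outside E shows that J_hat_r is the interaction of E with its complement at
   distances in [r, 1), plus J_1; by monotone convergence J_hat = H_1 + J_1. Splitting the exterior
   {|x - y| >= 1} in the same way gives H_hat = H_1 + J_1. Since J_1 is finite, everything follows. *)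

theory Submission
  imports Defs
begin

section \<open>Integrals of radial functions\<close>

lemma omega_nonneg: "0 \<le> omega TYPE('a::euclidean_space)"
  by (simp add: omega_def)

text \<open>Balls are open, so annuli give half-open intervals, whereas the fundamental theorem of
  calculus is applied on closed ones; one endpoint is a null set.\<close>

lemma nn_integral_Ico_eq_Icc:
  fixes a b :: real
  shows "(\<integral>\<^sup>+t. f t * indicator {a..<b} t \<partial>lborel) = (\<integral>\<^sup>+t. f t * indicator {a..b} t \<partial>lborel)"
proof (rule nn_integral_cong_AE)
  show "AE t in lborel. f t * indicator {a..<b} t = f t * indicator {a..b} t"
    using AE_lborel_singleton[of b] by eventually_elim (auto simp: indicator_def)
qed

text \<open>Polar coordinates, in the form needed for radial functions: d omega_d t^(d-1) is the
  area of the sphere of radius t. Half-lines \<open>{..<a}\<close> are stable under intersection and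
  generate the Borel sets, so it suffices that both measures give \<open>{..<a}\<close> the volume
  of the ball of radius a.\<close>

lemma distr_lborel_norm:
  "distr lborel borel (norm :: 'a::euclidean_space \<Rightarrow> real) =
    density lborel (\<lambda>t. ennreal (real DIM('a) * omega TYPE('a) * t ^ (DIM('a) - 1)) * indicator {0..} t)"
  (is "?M = ?N")
proof -
  let ?d = "DIM('a)" and ?w = "omega TYPE('a)"
  have w: "?w = unit_ball_vol ?d"
    by (simp add: omega_def content_ball)
  \<comment> \<open>\<open>max 0 a\<close> also covers a < 0, where the ball is empty and 0^d = 0
    because d \<ge> 1.\<close>
  have M: "emeasure ?M {..<a} = ennreal (?w * (max 0 a) ^ ?d)" for a
  proof (cases "0 \<le> a")
    case True
    have "emeasure ?M {..<a} = emeasure lborel (ball (0::'a) a)"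
      by (subst emeasure_distr) (auto simp: vimage_def ball_def lessThan_def)
    then show ?thesis using True by (simp add: emeasure_ball w)
  next
    case False
    then have e: "{x::'a. norm x < a} = {}"
      by (auto dest: order_le_less_trans[OF norm_ge_zero])
    have "emeasure ?M {..<a} = emeasure lborel {x::'a. norm x < a}"
      by (subst emeasure_distr) (auto simp: vimage_def)
    then show ?thesis using False e by (simp add: max_def power_0_left)
  qed
  have N: "emeasure ?N {..<a} = ennreal (?w * (max 0 a) ^ ?d)" for a
  proof (cases "0 \<le> a")
    case True
    have "emeasure ?N {..<a} = (\<integral>\<^sup>+t. ennreal (real ?d * ?w * t ^ (?d - 1)) * indicator {0..} t * indicator {..<a} t \<partial>lborel)"
      by (subst emeasure_density) auto
    also have "\<dots> = (\<integral>\<^sup>+t. ennreal (real ?d * ?w * t ^ (?d - 1)) * indicator {0..<a} t \<partial>lborel)"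
      by (intro nn_integral_cong) (auto split: split_indicator)
    also have "\<dots> = (\<integral>\<^sup>+t. ennreal (real ?d * ?w * t ^ (?d - 1)) * indicator {0..a} t \<partial>lborel)"
      by (rule nn_integral_Ico_eq_Icc)
    also have "\<dots> = ennreal (?w * a ^ ?d - ?w * 0 ^ ?d)"
      using True omega_nonneg[where 'a = 'a] by (intro nn_integral_FTC_Icc) (auto intro!: derivative_eq_intros)
    finally show ?thesis using True by (simp add: power_0_left)
  next
    case False
    have "emeasure ?N {..<a} = (\<integral>\<^sup>+t. ennreal (real ?d * ?w * t ^ (?d - 1)) * indicator {0..} t * indicator {..<a} t \<partial>lborel)"
      by (subst emeasure_density) auto
    also have "\<dots> = (\<integral>\<^sup>+t. 0 \<partial>(lborel :: real measure))"
      using False by (intro nn_integral_cong) (auto split: split_indicator)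
    finally show ?thesis using False by (simp add: max_def power_0_left)
  qed
  show ?thesis
  proof (rule measure_eqI_generator_eq[where E = "range lessThan" and \<Omega> = UNIV and A = "\<lambda>i. {..<real i}"])
    show "Int_stable (range (lessThan :: real \<Rightarrow> _))"
    proof (rule Int_stableI_image)
      show "\<exists>c\<in>UNIV. {..<a} \<inter> {..<b} = {..<c}" for a b :: real
        by (rule bexI[of _ "min a b"]) auto
    qed
    show "\<And>X. X \<in> range lessThan \<Longrightarrow> emeasure ?M X = emeasure ?N X"
      using M N by auto
    show "sets ?M = sigma_sets UNIV (range lessThan)" "sets ?N = sigma_sets UNIV (range lessThan)"
      by (simp_all add: borel_Iio)
    show "(\<Union>i. {..<real i}) = UNIV"
      by (simp add: set_eq_iff reals_Archimedean2)
    show "emeasure ?M {..<real i} \<noteq> \<infinity>" for i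
      unfolding M by simp
  qed auto
qed

text \<open>Translation invariance moves the centre x to the origin; then the law of the norm
  applies.\<close>

lemma nn_integral_dist:
  fixes x :: "'a::euclidean_space"
  assumes [measurable]: "g \<in> borel_measurable borel"
  shows "(\<integral>\<^sup>+y. g (dist x y) \<partial>lborel) =
    (\<integral>\<^sup>+t. ennreal (real DIM('a) * omega TYPE('a) * t ^ (DIM('a) - 1)) * indicator {0..} t * g t \<partial>lborel)"
proof -
  have "(\<integral>\<^sup>+y. g (dist x y) \<partial>lborel) = (\<integral>\<^sup>+y. g (dist x y) \<partial>distr lborel borel ((+) x))"
    by (simp add: lborel_distr_plus)
  also have "\<dots> = (\<integral>\<^sup>+y. g (norm (y::'a)) \<partial>lborel)"
    by (subst nn_integral_distr) (auto simp: dist_norm)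
  also have "\<dots> = (\<integral>\<^sup>+t. g t \<partial>distr lborel borel (norm :: 'a \<Rightarrow> real))"
    by (subst nn_integral_distr) auto
  also have "\<dots> = (\<integral>\<^sup>+t. ennreal (real DIM('a) * omega TYPE('a) * t ^ (DIM('a) - 1)) * indicator {0..} t * g t \<partial>lborel)"
    unfolding distr_lborel_norm by (subst nn_integral_density) auto
  finally show ?thesis .
qed

text \<open>The reason for the shape of gamma: it is a primitive of the radial density times the
  kernel, d omega_d t^(-\<sigma>-1). The logarithm is the primitive in the case \<sigma> =
  0.\<close>

lemma DERIV_gamma_const:
  assumes "0 < t"
  shows "(gamma_const TYPE('a::euclidean_space) \<sigma> has_real_derivative
    real DIM('a) * omega TYPE('a) * t ^ (DIM('a) - 1) * (1 / t powr (real DIM('a) + \<sigma>))) (at t)"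
proof -
  have eq: "t ^ (DIM('a) - 1) * (1 / t powr (real DIM('a) + \<sigma>)) = t powr (- \<sigma> - 1)"
  proof -
    have "t ^ (DIM('a) - 1) = t powr real (DIM('a) - 1)"
      using assms by (rule powr_realpow[symmetric])
    then show ?thesis
      using assms by (simp add: powr_diff[symmetric] of_nat_diff Suc_leI minus_diff_commute)
  qed
  have "(gamma_const TYPE('a) \<sigma> has_real_derivative real DIM('a) * omega TYPE('a) * t powr (- \<sigma> - 1)) (at t)"
  proof (cases "\<sigma> = 0")
    case True
    then show ?thesis
      using assms unfolding gamma_const_def[abs_def]
      by (auto intro!: derivative_eq_intros simp: powr_minus field_simps)
  next
    case False
    have "((\<lambda>\<rho>. \<rho> powr - \<sigma>) has_real_derivative - \<sigma> * t powr (- \<sigma> - 1)) (at t)"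
      using assms by (rule has_real_derivative_powr)
    then show ?thesis
      using False assms unfolding gamma_const_def[abs_def]
      by (auto intro!: derivative_eq_intros)
  qed
  then show ?thesis by (simp only: mult.assoc eq)
qed

lemma frac_kernel_eq:
  "frac_kernel \<sigma> (x::'a::euclidean_space) y = ennreal (1 / dist x y powr (real DIM('a) + \<sigma>))"
  by (simp add: frac_kernel_def dist_norm)

lemma nn_integral_frac_kernel_annulus:
  fixes x :: "'a::euclidean_space"
  assumes "0 < r" "r \<le> R"
  shows "(\<integral>\<^sup>+y. frac_kernel \<sigma> x y * indicator {r..<R} (dist x y) \<partial>lborel) =
    ennreal (gamma_const TYPE('a) \<sigma> R - gamma_const TYPE('a) \<sigma> r)"
proof -
  let ?f = "\<lambda>t. real DIM('a) * omega TYPE('a) * t ^ (DIM('a) - 1) * (1 / t powr (real DIM('a) + \<sigma>))"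
  have "(\<integral>\<^sup>+y. frac_kernel \<sigma> x y * indicator {r..<R} (dist x y) \<partial>lborel) =
      (\<integral>\<^sup>+t. ennreal (real DIM('a) * omega TYPE('a) * t ^ (DIM('a) - 1)) * indicator {0..} t
        * (ennreal (1 / t powr (real DIM('a) + \<sigma>)) * indicator {r..<R} t) \<partial>lborel)"
    unfolding frac_kernel_eq by (rule nn_integral_dist) measurable
  also have "\<dots> = (\<integral>\<^sup>+t. ennreal (?f t) * indicator {r..<R} t \<partial>lborel)"
    using \<open>0 < r\<close> by (intro nn_integral_cong)
       (auto split: split_indicator simp: ennreal_mult[symmetric] omega_nonneg)
  also have "\<dots> = (\<integral>\<^sup>+t. ennreal (?f t) * indicator {r..R} t \<partial>lborel)"
    by (rule nn_integral_Ico_eq_Icc)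
  also have "\<dots> = ennreal (gamma_const TYPE('a) \<sigma> R - gamma_const TYPE('a) \<sigma> r)"
  proof (rule nn_integral_FTC_Icc)
    show "(gamma_const TYPE('a) \<sigma> has_real_derivative ?f t) (at t)" if "t \<in> {r..R}" for t
      using that assms by (intro DERIV_gamma_const) auto
    show "0 \<le> ?f t" if "t \<in> {r..R}" for t
      using that \<open>0 < r\<close> by (auto simp: omega_nonneg)
  qed (use \<open>r \<le> R\<close> in auto)
  finally show ?thesis .
qed

lemma nn_integral_frac_kernel_exterior:
  fixes x :: "'a::euclidean_space"
  assumes "0 < \<sigma>"
  shows "(\<integral>\<^sup>+y. frac_kernel \<sigma> x y * indicator {1..} (dist x y) \<partial>lborel) =
    ennreal (real DIM('a) * omega TYPE('a) / \<sigma>)"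
proof -
  let ?f = "\<lambda>t. real DIM('a) * omega TYPE('a) * t ^ (DIM('a) - 1) * (1 / t powr (real DIM('a) + \<sigma>))"
  have "(\<integral>\<^sup>+y. frac_kernel \<sigma> x y * indicator {1..} (dist x y) \<partial>lborel) =
      (\<integral>\<^sup>+t. ennreal (real DIM('a) * omega TYPE('a) * t ^ (DIM('a) - 1)) * indicator {0..} t
        * (ennreal (1 / t powr (real DIM('a) + \<sigma>)) * indicator {1..} t) \<partial>lborel)"
    unfolding frac_kernel_eq by (rule nn_integral_dist) measurable
  also have "\<dots> = (\<integral>\<^sup>+t. ennreal (?f t) * indicator {1..} t \<partial>lborel)"
    by (intro nn_integral_cong)
       (auto split: split_indicator simp: ennreal_mult[symmetric] omega_nonneg)
  \<comment> \<open>The inner 0 is the limit of t^(-\<sigma>) at infinity, which exists because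
    \<sigma> > 0; the subtracted value of gamma at 1 vanishes.\<close>
  also have "\<dots> = ennreal (real DIM('a) * omega TYPE('a) * ((1 - 0) / \<sigma>) - gamma_const TYPE('a) \<sigma> 1)"
  proof (rule nn_integral_FTC_atLeast)
    have "((\<lambda>t. t powr - \<sigma>) \<longlongrightarrow> 0) at_top"
      using assms by (intro tendsto_neg_powr filterlim_ident) auto
    then have "((\<lambda>t. real DIM('a) * omega TYPE('a) * ((1 - t powr - \<sigma>) / \<sigma>))
        \<longlongrightarrow> real DIM('a) * omega TYPE('a) * ((1 - 0) / \<sigma>)) at_top"
      using assms by (intro tendsto_intros) auto
    then show "(gamma_const TYPE('a) \<sigma> \<longlongrightarrow> real DIM('a) * omega TYPE('a) * ((1 - 0) / \<sigma>)) at_top"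
      using assms by (simp add: gamma_const_def[abs_def])
    show "(gamma_const TYPE('a) \<sigma> has_real_derivative ?f t) (at t)" if "1 \<le> t" for t
      using that by (intro DERIV_gamma_const) simp
  qed (auto simp: omega_nonneg)
  also have "\<dots> = ennreal (real DIM('a) * omega TYPE('a) / \<sigma>)"
    by (simp add: gamma_const_def)
  finally show ?thesis .
qed

section \<open>The energy of an interaction at prescribed distances\<close>

text \<open>Lets an inner integral be measurable in the outer variable. A countable Borel cover by
  sets of finite measure keeps its measures under completion.\<close>

lemma sigma_finite_lebesgue: "sigma_finite_measure (lebesgue :: 'a::euclidean_space measure)"
proof
  obtain A :: "'a set set" where "countable A" "A \<subseteq> sets lborel" "\<Union>A = space lborel"
      "\<forall>a\<in>A. emeasure lborel a \<noteq> \<infinity>"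
    using lborel.sigma_finite_countable by blast
  then show "\<exists>A::'a set set. countable A \<and> A \<subseteq> sets lebesgue \<and> \<Union>A = space lebesgue \<and> (\<forall>a\<in>A. emeasure lebesgue a \<noteq> \<infinity>)"
    by (intro exI[of _ A]) auto
qed

text \<open>A common form for all double integrals in H and J: the balls become a condition T on the
  distance alone. The energy is then additive separately in the region F and in T.\<close>

definition frac_energy :: "real \<Rightarrow> 'a::euclidean_space set \<Rightarrow> 'a set \<Rightarrow> real set \<Rightarrow> ennreal" where
  "frac_energy \<sigma> E F T =
    (\<integral>\<^sup>+x\<in>E. (\<integral>\<^sup>+y\<in>F. frac_kernel \<sigma> x y * indicator T (dist x y) \<partial>lebesgue) \<partial>lebesgue)"

text \<open>The product here is not completed. The distance is nevertheless measurable, since the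
  identity is measurable from \<open>lebesgue\<close> to the Borel sets.\<close>

lemma measurable_dist_lebesgue [measurable]:
  "(\<lambda>(x::'a::euclidean_space, y). dist x y) \<in> borel_measurable (lebesgue \<Otimes>\<^sub>M lebesgue)"
proof -
  have [measurable]: "(\<lambda>x::'a. x) \<in> borel_measurable lebesgue"
    by (rule measurable_completion) simp
  show ?thesis by measurable
qed

lemma measurable_frac_energy_integrand:
  fixes F :: "'a::euclidean_space set"
  assumes [measurable]: "F \<in> sets lebesgue" "T \<in> sets borel"
  shows "(\<lambda>(x, y). frac_kernel \<sigma> x y * indicator T (dist x y) * indicator F y)
      \<in> borel_measurable (lebesgue \<Otimes>\<^sub>M lebesgue)"
  unfolding frac_kernel_eq by measurable

lemma measurable_frac_energy_inner:
  fixes E :: "'a::euclidean_space set"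
  assumes "E \<in> sets lebesgue" "F \<in> sets lebesgue" "T \<in> sets borel"
  shows "(\<lambda>x. (\<integral>\<^sup>+y\<in>F. frac_kernel \<sigma> x y * indicator T (dist x y) \<partial>lebesgue) * indicator E x)
      \<in> borel_measurable lebesgue"
    and "(\<lambda>y. frac_kernel \<sigma> x y * indicator T (dist x y) * indicator F y) \<in> borel_measurable lebesgue"
proof -
  interpret sigma_finite_measure "lebesgue :: 'a measure" by (rule sigma_finite_lebesgue)
  note [measurable] = assms measurable_frac_energy_integrand[OF assms(2,3), of \<sigma>]
  show "(\<lambda>x. (\<integral>\<^sup>+y\<in>F. frac_kernel \<sigma> x y * indicator T (dist x y) \<partial>lebesgue) * indicator E x)
      \<in> borel_measurable lebesgue"
    by measurable
  show "(\<lambda>y. frac_kernel \<sigma> x y * indicator T (dist x y) * indicator F y) \<in> borel_measurable lebesgue"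
    using measurable_compose_Pair1[OF _ measurable_frac_energy_integrand[OF assms(2,3), of \<sigma>], of x]
    by simp
qed

lemma frac_energy_Un_distance:
  fixes E :: "'a::euclidean_space set"
  assumes "E \<in> sets lebesgue" "F \<in> sets lebesgue" "S \<in> sets borel" "T \<in> sets borel" "S \<inter> T = {}"
  shows "frac_energy \<sigma> E F (S \<union> T) = frac_energy \<sigma> E F S + frac_energy \<sigma> E F T"
proof -
  have split: "frac_kernel \<sigma> x y * indicator (S \<union> T) (dist x y) * indicator F y
      = frac_kernel \<sigma> x y * indicator S (dist x y) * indicator F y + frac_kernel \<sigma> x y * indicator T (dist x y) * indicator F y" for x y :: 'a
    using assms by (simp add: indicator_add[symmetric] algebra_simps)
  show ?thesis
    unfolding frac_energy_def split using assms
    by (simp add: nn_integral_add measurable_frac_energy_inner distrib_right)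
qed

lemma frac_energy_Un_region:
  fixes E :: "'a::euclidean_space set"
  assumes "E \<in> sets lebesgue" "F \<in> sets lebesgue" "G \<in> sets lebesgue" "T \<in> sets borel" "F \<inter> G = {}"
  shows "frac_energy \<sigma> E (F \<union> G) T = frac_energy \<sigma> E F T + frac_energy \<sigma> E G T"
proof -
  have split: "frac_kernel \<sigma> x y * indicator T (dist x y) * indicator (F \<union> G) y
      = frac_kernel \<sigma> x y * indicator T (dist x y) * indicator F y + frac_kernel \<sigma> x y * indicator T (dist x y) * indicator G y" for x y :: 'a
    using assms by (simp add: indicator_add[symmetric] algebra_simps)
  show ?thesis
    unfolding frac_energy_def split using assms
    by (simp add: nn_integral_add measurable_frac_energy_inner distrib_right)
qed

text \<open>Monotone convergence twice, first in y for fixed x and then in x.\<close>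

lemma frac_energy_UN_distance:
  fixes E :: "'a::euclidean_space set"
  assumes "E \<in> sets lebesgue" "F \<in> sets lebesgue" "\<And>n. T n \<in> sets borel" "incseq T"
  shows "(\<lambda>n. frac_energy \<sigma> E F (T n)) \<longlonglongrightarrow> frac_energy \<sigma> E F (\<Union>n. T n)"
proof -
  have mono: "T m \<subseteq> T n" if "m \<le> n" for m n
    using assms(4) that by (auto dest: incseqD)
  let ?g = "\<lambda>n x y. frac_kernel \<sigma> x y * indicator (T n) (dist x y) * indicator F y"
  have inner: "(\<lambda>n. \<integral>\<^sup>+y. ?g n x y \<partial>lebesgue) \<longlonglongrightarrow>
      (\<integral>\<^sup>+y\<in>F. frac_kernel \<sigma> x y * indicator (\<Union>n. T n) (dist x y) \<partial>lebesgue)" for x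
  proof (rule nn_integral_LIMSEQ)
    show "incseq (\<lambda>n. ?g n x)"
      using mono by (auto simp: incseq_def le_fun_def split: split_indicator)
    show "(\<lambda>n. ?g n x y) \<longlonglongrightarrow> frac_kernel \<sigma> x y * indicator (\<Union>n. T n) (dist x y) * indicator F y" for y
    \<comment> \<open>For fixed x and y the sequence is eventually constant once the distance lies
      in some \<open>T n\<close>, and identically zero otherwise.\<close>
    proof (cases "\<exists>n. dist x y \<in> T n")
      case True
      then obtain n where "dist x y \<in> T n" by blast
      then have "\<forall>m\<ge>n. dist x y \<in> T m" using mono by blast
      then show ?thesis
        using True by (intro tendsto_eventually eventually_sequentiallyI[of n]) (auto split: split_indicator)
    qed auto
  qed (rule measurable_frac_energy_inner(2)[OF assms(1-3)])
  show ?thesis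
    unfolding frac_energy_def
  proof (rule nn_integral_LIMSEQ)
    show "incseq (\<lambda>n x. (\<integral>\<^sup>+y. ?g n x y \<partial>lebesgue) * indicator E x)"
      using mono
      by (fastforce simp: incseq_def le_fun_def intro!: mult_right_mono nn_integral_mono mult_left_mono indicator_leI)
    show "(\<lambda>n. (\<integral>\<^sup>+y. ?g n x y \<partial>lebesgue) * indicator E x) \<longlonglongrightarrow>
      (\<integral>\<^sup>+y\<in>F. frac_kernel \<sigma> x y * indicator (\<Union>n. T n) (dist x y) \<partial>lebesgue) * indicator E x" for x
      using inner[of x] by (auto split: split_indicator)
  qed (rule measurable_frac_energy_inner(1)[OF assms(1-3)])
qed

text \<open>Distance 0 can be left out because the two points lie in disjoint sets.\<close>

lemma H_fun_eq_frac_energy: "H_fun \<sigma> r E = frac_energy \<sigma> E (- E) {0<..<r}"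
  unfolding H_fun_def frac_energy_def
  by (auto intro!: nn_integral_cong simp: frac_kernel_def split: split_indicator)

lemma J_fun_eq_frac_energy: "J_fun \<sigma> r E = - enn2ereal (frac_energy \<sigma> E E {r..})"
  unfolding J_fun_def frac_energy_def
  by (intro arg_cong[where f = "\<lambda>t. - enn2ereal t"] nn_integral_cong)
     (auto intro!: nn_integral_cong split: split_indicator)

text \<open>The polar integrals do not depend on the centre x, so the outer integral only
  contributes |E|. They were computed for \<open>lborel\<close>, and completion does not change
  them.\<close>

lemma frac_energy_UNIV:
  fixes E :: "'a::euclidean_space set"
  assumes "E \<in> sets lebesgue"
    and "\<And>x::'a. (\<integral>\<^sup>+y. frac_kernel \<sigma> x y * indicator T (dist x y) \<partial>lborel) = c"
  shows "frac_energy \<sigma> E UNIV T = c * emeasure lebesgue E"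
proof -
  have "(\<integral>\<^sup>+y. frac_kernel \<sigma> x y * indicator T (dist x y) \<partial>lebesgue) = c" for x :: 'a
    using assms(2) by (simp only: nn_integral_completion)
  then show ?thesis
    unfolding frac_energy_def using assms(1) by (simp add: nn_integral_cmult_indicator)
qed

text \<open>At distances at least 1 the kernel is at most 1, since its exponent d + \<sigma> is
  nonnegative.\<close>

lemma frac_energy_le:
  fixes E :: "'a::euclidean_space set"
  assumes "E \<in> sets lebesgue" "F \<in> sets lebesgue" "0 \<le> \<sigma>"
  shows "frac_energy \<sigma> E F {1..} \<le> emeasure lebesgue F * emeasure lebesgue E"
proof -
  have "frac_kernel \<sigma> x y * indicator {1..} (dist x y) * indicator F y \<le> indicator F y" for x y :: 'a
    using assms(3) by (auto simp: frac_kernel_eq ge_one_powr_ge_zero divide_le_eq_1 split: split_indicator)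
  then have "(\<integral>\<^sup>+y\<in>F. frac_kernel \<sigma> x y * indicator {1..} (dist x y) \<partial>lebesgue) \<le> (\<integral>\<^sup>+y. indicator F y \<partial>lebesgue)" for x :: 'a
    by (intro nn_integral_mono)
  then have "(\<integral>\<^sup>+y\<in>F. frac_kernel \<sigma> x y * indicator {1..} (dist x y) \<partial>lebesgue) \<le> emeasure lebesgue F" for x :: 'a
    using assms by simp
  then have "frac_energy \<sigma> E F {1..} \<le> (\<integral>\<^sup>+x. emeasure lebesgue F * indicator E x \<partial>lebesgue)"
    unfolding frac_energy_def by (intro nn_integral_mono mult_right_mono) auto
  also have "\<dots> = emeasure lebesgue F * emeasure lebesgue E"
    using assms by (simp add: nn_integral_cmult_indicator)
  finally show ?thesis .
qed

section \<open>Comparison of the two renormalizations\<close>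

text \<open>The bound |E|^2 makes the long-range self-interaction a real number g, so that adding or
  cancelling it in \<open>ereal\<close> is safe.\<close>

lemma J_fun_one_finite:
  fixes E :: "'a::euclidean_space set"
  assumes "0 \<le> \<sigma>" "E \<in> sets lebesgue" "emeasure lebesgue E < \<infinity>"
  obtains g where "0 \<le> g" "frac_energy \<sigma> E E {1..} = ennreal g" "J_fun \<sigma> 1 E = ereal (- g)"
proof -
  have "emeasure lebesgue E = ennreal (measure lebesgue E)"
    using assms(3) by (intro emeasure_eq_ennreal_measure) auto
  then have "frac_energy \<sigma> E E {1..} < \<infinity>"
    using frac_energy_le[of E E \<sigma>] assms by (auto simp: ennreal_mult[symmetric] intro: le_less_trans)
  then obtain g where "0 \<le> g" "frac_energy \<sigma> E E {1..} = ennreal g"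
    by (cases "frac_energy \<sigma> E E {1..}") auto
  then show thesis
    by (intro that[of g]) (auto simp: J_fun_eq_frac_energy enn2ereal_ennreal)
qed

text \<open>With A and D the energies of E at distances in [r, 1) with itself and with its
  complement, A + D = -gamma_r |E|. Hence -(A + g) - gamma_r |E| = D - g, where g is the self-energy
  beyond distance 1.\<close>

lemma J_hat_rho_eq:
  fixes E :: "'a::euclidean_space set"
  assumes "0 \<le> \<sigma>" "E \<in> sets lebesgue" "emeasure lebesgue E < \<infinity>" "0 < r" "r < 1"
  shows "J_hat_rho \<sigma> r E = enn2ereal (frac_energy \<sigma> E (- E) {r..<1}) + J_fun \<sigma> 1 E"
proof -
  let ?D = "frac_energy \<sigma> E (- E) {r..<1}" and ?A = "frac_energy \<sigma> E E {r..<1}"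
  let ?G = "\<lambda>r. frac_energy \<sigma> E E {r..}"
  \<comment> \<open>This is the kernel integral over the annulus from r to 1, as gamma vanishes at
    1.\<close>
  let ?c = "- gamma_const TYPE('a) \<sigma> r" and ?m = "measure lebesgue E"
  have E: "emeasure lebesgue E = ennreal ?m"
    using assms(3) by (intro emeasure_eq_ennreal_measure) auto
  have cE: "- E \<in> sets lebesgue"
    using assms(2) by (metis Compl_in_sets_lebesgue)
  have c0: "0 \<le> ?c"
    using assms unfolding gamma_const_def
    by (auto simp: omega_nonneg mult_nonneg_nonpos divide_le_0_iff ge_one_powr_ge_zero powr_minus one_le_inverse_iff powr_le1)
  have "?A + ?D = frac_energy \<sigma> E UNIV {r..<1}"
    using frac_energy_Un_region[of E E "- E" "{r..<1}" \<sigma>] assms cE by simp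
  also have "\<dots> = ennreal ?c * ennreal ?m"
    unfolding E[symmetric] using assms nn_integral_frac_kernel_annulus[of r 1 \<sigma>]
    by (intro frac_energy_UNIV) (auto simp: gamma_const_def)
  finally have AD: "?A + ?D = ennreal (?c * ?m)"
    by (subst ennreal_mult'') simp_all
  have "{r..} = {r..<1} \<union> {1..}" using assms by auto
  then have G: "?G r = ?A + ?G 1"
    using frac_energy_Un_distance[of E E "{r..<1}" "{1..}" \<sigma>] assms
    by (simp add: ivl_disj_int)
  obtain g where g: "0 \<le> g" "?G 1 = ennreal g"
    using J_fun_one_finite[OF assms(1-3)] by metis
  have "?A < \<infinity>" "?D < \<infinity>"
    using AD by (metis ennreal_less_top infinity_ennreal_def ennreal_add_less_top)+
  then obtain a e where a: "?A = ennreal a" "0 \<le> a" and e: "?D = ennreal e" "0 \<le> e"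
    by (cases "?A"; cases "?D") auto
  \<comment> \<open>\<open>ennreal\<close> sends negative reals to 0, so the identity passes to the
    reals only with both sides known to be nonnegative; for \<open>?c\<close> this uses r <
    1.\<close>
  have "a + e = ?c * ?m"
  proof (rule ennreal_inj[THEN iffD1])
    show "0 \<le> ?c * ?m" using c0 by (rule mult_nonneg_nonneg) simp
    show "ennreal (a + e) = ennreal (?c * ?m)" using AD a e by simp
  qed (use a e in simp)
  then show ?thesis
    unfolding J_hat_rho_def J_fun_eq_frac_energy G using a e g
    by (simp add: enn2ereal_ennreal flip: ennreal_plus)
qed

lemma J_hat_eq:
  fixes E :: "'a::euclidean_space set"
  assumes "0 \<le> \<sigma>" "E \<in> sets lebesgue" "emeasure lebesgue E < \<infinity>"
  shows "J_hat \<sigma> E = enn2ereal (H_fun \<sigma> 1 E) + J_fun \<sigma> 1 E"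
  unfolding J_hat_def
proof (rule tendsto_Lim)
  show "((\<lambda>r. J_hat_rho \<sigma> r E) \<longlongrightarrow> enn2ereal (H_fun \<sigma> 1 E) + J_fun \<sigma> 1 E) (at_right 0)"
  \<comment> \<open>Along a decreasing sequence of radii in (0, 1) the distance sets increase, as
    monotone convergence requires.\<close>
  proof (rule tendsto_at_right_sequentially[of 0 1])
    fix S :: "nat \<Rightarrow> real"
    assume S: "\<And>n. 0 < S n" "\<And>n. S n < 1" "decseq S" "S \<longlonglongrightarrow> 0"
    have cE: "- E \<in> sets lebesgue"
      using assms(2) by (metis Compl_in_sets_lebesgue)
    have "(\<Union>n. {S n..<1}) = {0<..<1}"
    proof safe
      fix x :: real assume "x \<in> {0<..<1}"
      then have "\<exists>n. S n < x"
        using order_tendstoD(2)[OF S(4), of x] by (auto simp: eventually_sequentially)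
      then show "x \<in> (\<Union>n. {S n..<1})" using \<open>x \<in> {0<..<1}\<close> by (auto intro: less_imp_le)
    qed (use S(1) in \<open>auto intro: less_le_trans\<close>)
    moreover have "incseq (\<lambda>n. {S n..<1})"
      using S(3) by (auto simp: incseq_def decseq_def intro: order_trans)
    ultimately have "(\<lambda>n. frac_energy \<sigma> E (- E) {S n..<1}) \<longlonglongrightarrow> H_fun \<sigma> 1 E"
      using frac_energy_UN_distance[of E "- E" "\<lambda>n. {S n..<1}" \<sigma>] assms cE
      by (simp add: H_fun_eq_frac_energy)
    \<comment> \<open>\<open>H_fun\<close> may be infinite; finiteness of the other summand makes
      addition continuous at the limit.\<close>
    moreover have "\<bar>J_fun \<sigma> 1 E\<bar> \<noteq> \<infinity>"
      using J_fun_one_finite[OF assms] by (metis abs_ereal.simps(1) ereal.distinct(1) PInfty_neq_ereal(1))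
    ultimately show "(\<lambda>n. J_hat_rho \<sigma> (S n) E) \<longlonglongrightarrow> enn2ereal (H_fun \<sigma> 1 E) + J_fun \<sigma> 1 E"
      using S assms by (auto simp: J_hat_rho_eq intro!: tendsto_add_ereal_general)
  qed simp
qed simp

text \<open>For \<sigma> = 0 this is the definition. For \<sigma> > 0, let g and p be the energies
  of E beyond distance 1 with itself and with its complement. Then d omega_d |E| / \<sigma> = g + p,
  and subtracting this from H_1 + p leaves H_1 - g.\<close>

lemma H_hat_eq:
  fixes E :: "'a::euclidean_space set"
  assumes "0 \<le> \<sigma>" "E \<in> sets lebesgue" "emeasure lebesgue E < \<infinity>"
  shows "H_hat \<sigma> E = enn2ereal (H_fun \<sigma> 1 E) + J_fun \<sigma> 1 E"
proof (cases "\<sigma> = 0")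
  case True
  then show ?thesis by (simp add: H_hat_def)
next
  case False
  then have "0 < \<sigma>" using assms by simp
  let ?P = "frac_energy \<sigma> E (- E) {1..}" and ?c = "real DIM('a) * omega TYPE('a) / \<sigma>"
    and ?m = "measure lebesgue E"
  have E: "emeasure lebesgue E = ennreal ?m"
    using assms(3) by (intro emeasure_eq_ennreal_measure) auto
  have cE: "- E \<in> sets lebesgue"
    using assms(2) by (metis Compl_in_sets_lebesgue)
  have c0: "0 \<le> ?c"
    using \<open>0 < \<sigma>\<close> by (simp add: omega_nonneg)
  obtain g where g: "0 \<le> g" "frac_energy \<sigma> E E {1..} = ennreal g" "J_fun \<sigma> 1 E = ereal (- g)"
    using J_fun_one_finite[OF assms] .
  have "frac_energy \<sigma> E E {1..} + ?P = frac_energy \<sigma> E UNIV {1..}"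
    using frac_energy_Un_region[of E E "- E" "{1..}" \<sigma>] assms cE by simp
  also have "\<dots> = ennreal ?c * ennreal ?m"
    unfolding E[symmetric] using assms nn_integral_frac_kernel_exterior[OF \<open>0 < \<sigma>\<close>]
    by (intro frac_energy_UNIV) auto
  finally have GP: "ennreal g + ?P = ennreal (?c * ?m)"
    using g by (subst ennreal_mult'') simp_all
  then have "?P < \<infinity>"
    by (metis ennreal_less_top infinity_ennreal_def ennreal_add_less_top)
  then obtain p where p: "?P = ennreal p" "0 \<le> p" by (cases ?P) auto
  have gp: "g + p = ?c * ?m"
  proof (rule ennreal_inj[THEN iffD1])
    show "0 \<le> ?c * ?m" using c0 by (rule mult_nonneg_nonneg) simp
    show "ennreal (g + p) = ennreal (?c * ?m)" using GP g p by simp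
  qed (use g p in simp)
  \<comment> \<open>Distance 0 is omitted from the union because x lies in E and y does not.\<close>
  have "(\<integral>\<^sup>+x\<in>E. (\<integral>\<^sup>+y\<in>UNIV - E. frac_kernel \<sigma> x y \<partial>lebesgue) \<partial>lebesgue)
      = frac_energy \<sigma> E (- E) ({0<..<1} \<union> {1..})"
    unfolding frac_energy_def
    by (auto intro!: nn_integral_cong simp: frac_kernel_def split: split_indicator)
  also have "\<dots> = H_fun \<sigma> 1 E + ?P"
    using assms cE by (subst frac_energy_Un_distance) (auto simp: H_fun_eq_frac_energy)
  finally have "H_hat \<sigma> E = enn2ereal (H_fun \<sigma> 1 E + ennreal p) - ereal (g + p)"
    using False by (simp add: H_hat_def gp p)
  then show ?thesis
    using g p by (cases "H_fun \<sigma> 1 E") (auto simp: enn2ereal_ennreal simp flip: ennreal_plus)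
qed

theorem theorem4p1:
  fixes \<sigma> :: real and E :: "'a::euclidean_space set"
  assumes "0 \<le> \<sigma>" and "\<sigma> < 1"
    and "E \<in> sets lebesgue" and "emeasure lebesgue E < \<infinity>"
  shows "J_hat \<sigma> E = H_hat \<sigma> E
    \<and> (\<bar>J_hat \<sigma> E\<bar> \<noteq> \<infinity> \<longleftrightarrow> H_fun \<sigma> 1 E < \<infinity>)
    \<and> (\<bar>H_hat \<sigma> E\<bar> \<noteq> \<infinity> \<longleftrightarrow> H_fun \<sigma> 1 E < \<infinity>)"
proof -
  \<comment> \<open>Both functionals equal H_1 - g with g real, so they are finite exactly when H_1
    is.\<close>
  obtain g where "J_fun \<sigma> 1 E = ereal (- g)"
    using J_fun_one_finite[OF assms(1,3,4)] .
  then show ?thesis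
    unfolding J_hat_eq[OF assms(1,3,4)] H_hat_eq[OF assms(1,3,4)]
    by (cases "H_fun \<sigma> 1 E") (auto simp: enn2ereal_ennreal)
qed

end
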